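(* Let $n\geq 2$, let $\Lambda=(\lambda_1,\dots,\lambda_n)$ be an $n$-tuple of relatively prime positive integers, let $\Omega\subset\mathbb{C}^n$ be a $\Lambda$-nonisotropically balanced pseudoconvex domain, and let $\mathrm{h}_{\Lambda,\Omega}$ be its Minkowski $\Lambda$-functional. Let $L:=\max\{\lambda_j : j=1,\dots,n\}$. Then, for any $z\in\Omega$, the Lempert function $\widetilde{\kappa}_\Omega$ satisfies \[ \tanh^{-1}\big(\mathrm{h}_{\Lambda,\Omega}(z)^L\big)\ \leq\ \widetilde{\kappa}_\Omega(0,z)\ \leq\ \tanh^{-1}\big(\mathrm{h}_{\Lambda,\Omega}(z)\big). \]
   Context: $D$ denotes the open unit disc in $\mathbb{C}$ and $\overline{D}$ its closure. A domain is a nonempty connected open set. Let $\Lambda=(\lambda_1,\dots,\lambda_n)$ be an $n$-tuple of positive integers that are relatively prime. A domain $\Omega\subset\mathbb{C}^n$, $n\geq 2$, is $\Lambda$-nonisotropically balanced if, whenever $z=(z_1,\dots,z_n)\in\Omega$, then $(\zeta^{\lambda_1}z_1,\dots,\zeta^{\lambda_n}z_n)\in\Omega$ for all $\zeta\in\overline{D}$. The Minkowski $\Lambda$-functional of such an $\Omega$ is defined for $z\in\mathbb{C}^n$ by \[ \mathrm{h}_{\Lambda,\Omega}(z):=\inf\left\{t>0:\left(\frac{z_1}{t^{\lambda_1}},\dots,\frac{z_n}{t^{\lambda_n}}\right)\in\Omega\right\}. \] $\mathcal{O}(X;Y)$ denotes the class of holomorphic maps from $X$ into $Y$. The Lempert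 function of a domain $\Omega$ is defined, for $z_1,z_2\in\Omega$, by \[ \widetilde{\kappa}_\Omega(z_1,z_2):=\inf\{p_D(0,\zeta):\zeta\in D \text{ and } \exists\,\varphi\in\mathcal{O}(D;\Omega)\text{ such that }\varphi(0)=z_1,\ \varphi(\zeta)=z_2\}, \] where $p_D$ is the Poincaré distance on $D$, normalized so that $p_D(\zeta_1,\zeta_2)=\tanh^{-1}\left|\frac{\zeta_2-\zeta_1}{1-\overline{\zeta_1}\zeta_2}\right|$. *)

theory Defs
  imports "HOL-Complex_Analysis.Complex_Analysis"
begin

text \<open>The space \<open>\<complex>\<^sup>n\<close> is the type \<open>complex ^ 'n\<close> with \<open>n = CARD('n)\<close>, and a tuple of weights is a
  function \<open>\<Lambda> :: 'n \<Rightarrow> nat\<close>. The open unit disc is \<open>ball 0 1 :: complex set\<close>.\<close>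

definition is_domain :: "'a::topological_space set \<Rightarrow> bool" where
  "is_domain \<Omega> \<longleftrightarrow> open \<Omega> \<and> connected \<Omega> \<and> \<Omega> \<noteq> {}"

definition nonisotropically_balanced :: "('n::finite \<Rightarrow> nat) \<Rightarrow> (complex ^ 'n) set \<Rightarrow> bool" where
  "nonisotropically_balanced \<Lambda> \<Omega> \<longleftrightarrow>
     is_domain \<Omega> \<and> (\<forall>z\<in>\<Omega>. \<forall>\<zeta>\<in>cball (0::complex) 1. (\<chi> j. \<zeta> ^ \<Lambda> j * z $ j) \<in> \<Omega>)"

text \<open>If all weights are positive and \<open>\<Omega>\<close> is \<open>\<Lambda>\<close>-nonisotropically balanced, then \<open>\<Omega>\<close> is a neighbourhood
  of the origin, so the infimum below is over a nonempty set of positive reals.\<close>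

definition minkowski_functional ::
    "('n::finite \<Rightarrow> nat) \<Rightarrow> (complex ^ 'n) set \<Rightarrow> complex ^ 'n \<Rightarrow> real" where
  "minkowski_functional \<Lambda> \<Omega> z = Inf {t. t > 0 \<and> (\<chi> j. z $ j / complex_of_real t ^ \<Lambda> j) \<in> \<Omega>}"

text \<open>A continuous real-valued function is plurisubharmonic iff its restriction to every complex line
  is subharmonic, i.e. satisfies the sub-mean value inequality on every closed disc
  \<open>{a + \<zeta> b : \<bar>\<zeta>\<bar> \<le> 1}\<close> that lies in a complex line and is contained in \<open>\<Omega>\<close>. (Centre and radius are
  absorbed into \<open>a\<close> and \<open>b\<close>.)\<close>

definition continuous_plurisubharmonic_on ::
    "(complex ^ 'n \<Rightarrow> real) \<Rightarrow> (complex ^ 'n::finite) set \<Rightarrow> bool" where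
  "continuous_plurisubharmonic_on u \<Omega> \<longleftrightarrow>
     continuous_on \<Omega> u \<and>
     (\<forall>a b. (\<forall>\<zeta>\<in>cball (0::complex) 1. a + \<zeta> *s b \<in> \<Omega>) \<longrightarrow>
        u a \<le> integral {0..2 * pi} (\<lambda>t. u (a + cis t *s b)) / (2 * pi))"

text \<open>Pseudoconvexity: existence of a continuous plurisubharmonic exhaustion function. As \<open>u\<close> is
  continuous on \<open>\<Omega>\<close>, compactness of all sublevel sets \<open>{u \<le> c}\<close> says the same as relative
  compactness in \<open>\<Omega>\<close> of all sublevel sets \<open>{u < c}\<close>.\<close>

definition pseudoconvex :: "(complex ^ 'n::finite) set \<Rightarrow> bool" where
  "pseudoconvex \<Omega> \<longleftrightarrow>
     open \<Omega> \<and> (\<exists>u. continuous_plurisubharmonic_on u \<Omega> \<and> (\<forall>c. compact {z \<in> \<Omega>. u z \<le> c}))"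

definition holomorphic_map :: "complex set \<Rightarrow> (complex ^ 'n::finite) set \<Rightarrow> (complex \<Rightarrow> complex ^ 'n) \<Rightarrow> bool"
  where "holomorphic_map X Y \<phi> \<longleftrightarrow> (\<forall>j. (\<lambda>w. \<phi> w $ j) holomorphic_on X) \<and> \<phi> ` X \<subseteq> Y"

definition poincare_dist :: "complex \<Rightarrow> complex \<Rightarrow> real" where
  "poincare_dist \<zeta>\<^sub>1 \<zeta>\<^sub>2 = artanh (norm ((\<zeta>\<^sub>2 - \<zeta>\<^sub>1) / (1 - cnj \<zeta>\<^sub>1 * \<zeta>\<^sub>2)))"

text \<open>For a domain \<open>\<Omega>\<close> any two points lie on a common analytic disc, so the infimum is
  over a nonempty set of nonnegative reals.\<close>

definition lempert_function ::
    "(complex ^ 'n::finite) set \<Rightarrow> complex ^ 'n \<Rightarrow> complex ^ 'n \<Rightarrow> real" where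
  "lempert_function \<Omega> z\<^sub>1 z\<^sub>2 =
     Inf {poincare_dist 0 \<zeta> | \<zeta>. \<zeta> \<in> ball 0 1 \<and>
            (\<exists>\<phi>. holomorphic_map (ball 0 1) \<Omega> \<phi> \<and> \<phi> 0 = z\<^sub>1 \<and> \<phi> \<zeta> = z\<^sub>2)}"

end

theory Submission
  imports Defs
begin

text \<open>The upper bound comes from the discs \<open>\<zeta> \<mapsto> (\<zeta>\<^sup>\<lambda>\<^sub>j z\<^sub>j / t\<^sup>\<lambda>\<^sub>j)\<^sub>j\<close>. For the lower bound let \<open>\<phi>\<close> be a disc in \<open>\<Omega>\<close>
  with \<open>\<phi> 0 = 0\<close>, and let \<open>0 < r < 1\<close>. Substituting \<open>r w\<^sup>L\<close> makes \<open>\<phi>\<^sub>j(r w\<^sup>L)\<close> divisible by every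
  \<open>w\<^sup>\<lambda>\<^sub>j\<close>, so \<open>F\<^sub>\<alpha>(w) = (\<alpha>\<^sup>\<lambda>\<^sub>j \<phi>\<^sub>j(r w\<^sup>L) / w\<^sup>\<lambda>\<^sub>j)\<^sub>j\<close> for \<open>0 \<le> \<alpha> \<le> 1\<close> is a family of closed analytic discs
  with \<open>F\<^sub>0 = 0\<close> whose boundaries lie in \<open>\<Omega>\<close> because \<open>\<Omega>\<close> is balanced. By the continuity principle
  \<open>F\<^sub>1\<close> maps into \<open>\<Omega>\<close>, which says \<open>h(\<phi>(\<zeta>))\<^sup>L \<le> \<bar>\<zeta>\<bar> / r\<close>. Now let \<open>r\<close> tend to 1.\<close>

unbundle no fps_syntax

section \<open>The inverse hyperbolic tangent on (-1, 1)\<close>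

lemma tanh_artanh_real:
  fixes x :: real
  assumes "\<bar>x\<bar> < 1"
  shows "tanh (artanh x) = x"
proof -
  define y where "y = (1 + x) / (1 - x)"
  have y: "y > 0" using assms by (auto simp: y_def)
  have "artanh x = ln (sqrt y)"
    using y by (simp add: artanh_def y_def ln_sqrt)
  then have "tanh (artanh x) = (y - 1) / (y + 1)"
    using y by (simp add: tanh_ln_real)
  also have "\<dots> = x"
    using assms by (auto simp: y_def field_simps)
  finally show ?thesis .
qed

lemma artanh_real_le_iff:
  fixes x y :: real
  assumes "\<bar>x\<bar> < 1" "\<bar>y\<bar> < 1"
  shows "artanh x \<le> artanh y \<longleftrightarrow> x \<le> y"
  by (metis assms tanh_artanh_real tanh_real_le_iff)

section \<open>The maximum principle on closed analytic discs\<close>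

text \<open>This is the real part of Cauchy's integral formula at the centre of the circle. It
  serves to remove first-order terms from circular means.\<close>

lemma has_integral_Re_circle_mean:
  assumes "G holomorphic_on cball 0 \<eta>" "0 < \<eta>"
  shows "((\<lambda>t. Re (G (of_real \<eta> * cis t))) has_integral 2 * pi * Re (G 0)) {0..2*pi}"
proof -
  have "((\<lambda>u. G u / (u - 0)) has_contour_integral (2 * of_real pi * \<i> * G 0)) (circlepath 0 \<eta>)"
    using assms by (intro Cauchy_integral_circlepath_simple) auto
  then have "((\<lambda>t. \<i> * G (of_real \<eta> * cis t)) has_integral 2 * of_real pi * \<i> * G 0) {0..2*pi}"
    unfolding circlepath_def using assms
    by (subst (asm) has_contour_integral_part_circlepath_iff) (auto simp: mult.commute mult.left_commute)
  from has_integral_mult_right[OF this, of "-\<i>"]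
  have "((\<lambda>t. G (of_real \<eta> * cis t)) has_integral 2 * of_real pi * G 0) {0..2*pi}"
    by (simp add: algebra_simps)
  from has_integral_Re[OF this] show ?thesis by simp
qed

text \<open>A vector norm is at most the sum of the component norms, so an error rate of
  \<open>e / CARD('n)\<close> in each component suffices.\<close>

lemma eventually_norm_vec_linearization_le:
  fixes f :: "complex \<Rightarrow> complex ^ 'n::finite"
  assumes "\<And>j. ((\<lambda>w. f w $ j) has_field_derivative b $ j) (at w)" "e > 0"
  shows "\<forall>\<^sub>F x in nhds 0. norm (f (w + x) - f w - x *s b) \<le> e * norm x"
proof -
  define d where "d = e / CARD('n)"
  have d: "d > 0" using assms by (simp add: d_def)
  have "\<forall>\<^sub>F x in nhds 0. norm (f (w + x) $ j - f w $ j - x * b $ j) \<le> d * norm x" for j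
  proof -
    obtain D where D: "D > 0"
      "\<And>y. norm (y - w) < D \<Longrightarrow> norm (f y $ j - f w $ j - b $ j * (y - w)) \<le> d * norm (y - w)"
      using assms(1)[of j, unfolded has_field_derivative_def has_derivative_at_alt] d by blast
    show ?thesis
      unfolding eventually_nhds_metric
      using D(1) D(2)[of "w + _"] by (intro exI[of _ D]) (auto simp: mult.commute)
  qed
  then have "\<forall>\<^sub>F x in nhds 0. \<forall>j. norm (f (w + x) $ j - f w $ j - x * b $ j) \<le> d * norm x"
    by (rule eventually_all_finite)
  then show ?thesis
  proof eventually_elim
    case (elim x)
    have "norm (f (w + x) - f w - x *s b) \<le> (\<Sum>j\<in>UNIV. norm ((f (w + x) - f w - x *s b) $ j))"
      unfolding norm_vec_def by (rule L2_set_le_sum) auto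
    also have "\<dots> \<le> (\<Sum>j\<in>(UNIV::'n set). d * norm x)"
      using elim by (intro sum_mono) auto
    finally show ?case by (simp add: d_def)
  qed
qed

text \<open>Plurisubharmonicity is only given along complex lines and \<open>u\<close> need not be smooth. Instead of
  regularizing \<open>u\<close>, the variables are doubled: at an interior maximum of
  \<open>u (f w + v) + \<epsilon> \<bar>w\<bar>\<^sup>2 - K \<bar>v\<bar>\<^sup>2\<close> one moves the point \<open>f w + v\<close> along the tangent line of the disc,
  which changes the penalty only by a term of higher order.\<close>

lemma psh_disc_le_boundary:
  fixes f :: "complex \<Rightarrow> complex ^ 'n::finite"
  assumes psh: "continuous_plurisubharmonic_on u \<Omega>" and op: "open \<Omega>"
    and contf: "continuous_on (cball 0 1) f"
    and holf: "\<And>j. (\<lambda>w. f w $ j) holomorphic_on ball 0 1"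
    and sub: "f ` cball 0 1 \<subseteq> \<Omega>"
    and bd: "\<And>w. norm w = 1 \<Longrightarrow> u (f w) \<le> m"
    and w0: "w0 \<in> cball 0 1"
  shows "u (f w0) \<le> m"
proof (rule ccontr)
  assume "\<not> u (f w0) \<le> m"
  \<comment> \<open>Of the gap 3 \<open>\<epsilon>\<close>, one third pays for the term
    \<open>\<epsilon> * (norm w)\<^sup>2\<close>, one for the shift by \<open>v\<close>, and the
    last keeps the estimate on the unit circle strict.\<close>
  define \<epsilon> where "\<epsilon> = (u (f w0) - m) / 3"
  have \<epsilon>: "\<epsilon> > 0" "u (f w0) > m + 2 * \<epsilon>"
    using \<open>\<not> _\<close> by (auto simp: \<epsilon>_def field_simps)
  have contu: "continuous_on \<Omega> u"
    using psh by (auto simp: continuous_plurisubharmonic_on_def)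
  have cimg: "compact (f ` cball 0 1)"
    using contf by (intro compact_continuous_image) auto
  obtain d where d: "d > 0" "\<And>w v. w \<in> cball 0 1 \<Longrightarrow> norm v \<le> d \<Longrightarrow> f w + v \<in> \<Omega>"
  proof -
    obtain d where "d > 0" "(\<Union>x\<in>f ` cball 0 1. ball x d) \<subseteq> \<Omega>"
      using compact_subset_open_imp_ball_epsilon_subset[OF cimg op sub] by blast
    moreover have "f w + v \<in> (\<Union>x\<in>f ` cball 0 1. ball x d)"
      if "w \<in> cball 0 1" "norm v \<le> d / 2" for w v
      using that \<open>d > 0\<close> by (intro UN_I[of "f w"]) (auto simp: dist_norm)
    ultimately show ?thesis
      by (intro that[of "d/2"]) auto
  qed
  have contp: "continuous_on (cball 0 d \<times> cball 0 1) (\<lambda>p. f (snd p) + fst p)"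
    by (intro continuous_intros continuous_on_compose2[OF contf]) auto
  have contup: "continuous_on (cball 0 d \<times> cball 0 1) (\<lambda>p. u (f (snd p) + fst p))"
    using d(2) by (intro continuous_on_compose2[OF contu contp]) auto
  \<comment> \<open>Uniform continuity gives one radius \<open>\<delta>\<close> for all
    \<open>w\<close> such that a shift by \<open>v\<close> raises \<open>u\<close> by less than
    \<open>\<epsilon>\<close>.\<close>
  have "uniformly_continuous_on (cball 0 d \<times> cball 0 1) (\<lambda>p. u (f (snd p) + fst p))"
    by (intro compact_uniformly_continuous contup compact_Times) auto
  then obtain D where D: "D > 0"
    "\<And>p q. p \<in> cball 0 d \<times> cball 0 1 \<Longrightarrow> q \<in> cball 0 d \<times> cball 0 1 \<Longrightarrow> dist q p < D
      \<Longrightarrow> dist (u (f (snd q) + fst q)) (u (f (snd p) + fst p)) < \<epsilon>"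
    unfolding uniformly_continuous_on_def using \<epsilon>(1) by metis
  define \<delta> where "\<delta> = min d (D / 2)"
  have \<delta>: "\<delta> > 0" "\<delta> \<le> d" using d D by (auto simp: \<delta>_def)
  have near: "u (f w + v) < u (f w) + \<epsilon>" if "w \<in> cball 0 1" "norm v \<le> \<delta>" for w v
    using D(2)[of "(0, w)" "(v, w)"] that \<delta> D(1) d(1) by (auto simp: dist_norm \<delta>_def norm_Pair)
  have "compact ((\<lambda>w. u (f w)) ` cball 0 1)"
    using sub by (intro compact_continuous_image continuous_on_compose2[OF contu contf]) auto
  then obtain B where B: "\<And>w. w \<in> cball 0 1 \<Longrightarrow> u (f w) \<le> B"
    using bounded_imp_bdd_above[OF compact_imp_bounded] by (force simp: bdd_above_def)
  \<comment> \<open>With this \<open>K\<close> the penalty at \<open>norm v = \<delta>\<close>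
    exceeds everything that \<open>u\<close> and the \<open>\<epsilon>\<close>-terms can gain over
    \<open>u (f w0)\<close>, so the maximum has \<open>norm v < \<delta>\<close>.\<close>
  define K where "K = (\<bar>B + 2 * \<epsilon> - u (f w0)\<bar> + 1) / \<delta>\<^sup>2"
  have K: "K > 0" "B + 2 * \<epsilon> - K * \<delta>\<^sup>2 < u (f w0)"
    using \<delta> by (auto simp: K_def)
  define \<Psi> where "\<Psi> = (\<lambda>p. u (f (snd p) + fst p) + \<epsilon> * (norm (snd p))\<^sup>2 - K * (norm (fst p))\<^sup>2)"
  have "continuous_on (cball 0 \<delta> \<times> cball 0 1) \<Psi>"
    unfolding \<Psi>_def using \<delta> by (intro continuous_intros continuous_on_subset[OF contup]) auto
  then obtain p where p: "p \<in> cball 0 \<delta> \<times> cball 0 1"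
      "\<And>q. q \<in> cball 0 \<delta> \<times> cball 0 1 \<Longrightarrow> \<Psi> q \<le> \<Psi> p"
    using continuous_attains_sup[of "cball (0 :: complex^'n) \<delta> \<times> cball (0::complex) 1" \<Psi>] \<delta>
    by (auto simp: compact_Times)
  obtain v w where vw: "p = (v, w)" by fastforce
  have le: "norm v \<le> \<delta>" "norm w \<le> 1" using p(1) vw by auto
  have "\<Psi> (0, w0) \<le> \<Psi> p" using p(2)[of "(0, w0)"] w0 \<delta> by auto
  moreover have "\<Psi> (0, w0) \<ge> u (f w0)" using \<epsilon> by (auto simp: \<Psi>_def)
  ultimately have big: "u (f w0) \<le> u (f w + v) + \<epsilon> * (norm w)\<^sup>2 - K * (norm v)\<^sup>2"
    by (simp add: \<Psi>_def vw)
  have "\<epsilon> * (norm w)\<^sup>2 \<le> \<epsilon>"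
    using le \<epsilon> by (simp add: power_le_one)
  with big near[of w v] le have big': "u (f w0) < u (f w) + 2 * \<epsilon> - K * (norm v)\<^sup>2"
    by auto
  have v: "norm v < \<delta>"
  proof (rule ccontr)
    assume "\<not> norm v < \<delta>"
    then have "norm v = \<delta>" using le by auto
    then show False using big' K(2) B[of w] le by auto
  qed
  have w: "norm w < 1"
  proof (rule ccontr)
    assume "\<not> norm w < 1"
    then have "u (f w) \<le> m" using le by (intro bd) auto
    moreover have "K * (norm v)\<^sup>2 \<ge> 0" using K by auto
    ultimately show False using big' \<epsilon>(2) by linarith
  qed
  define b where "b = (\<chi> j. deriv (\<lambda>w. f w $ j) w)"
  have deriv: "((\<lambda>w. f w $ j) has_field_derivative b $ j) (at w)" for j
    using holomorphic_derivI[OF holf[of j], of w] w by (simp add: b_def)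
  define r where "r = (\<lambda>x. f (w + x) - f w - x *s b)"
  \<comment> \<open>Chosen so that the penalty \<open>K * (norm (r x))\<^sup>2\<close> of the
    linearization error uses up only half of the gain \<open>\<epsilon> * \<eta>\<^sup>2\<close>
    that comes from \<open>\<epsilon> * (norm (w + x))\<^sup>2\<close>.\<close>
  define e where "e = sqrt (\<epsilon> / (2 * K))"
  have e: "e > 0" "K * e\<^sup>2 = \<epsilon> / 2" using \<epsilon> K by (auto simp: e_def field_simps)
  define z where "z = f w + v"
  have "z \<in> \<Omega>" unfolding z_def using d(2)[of w v] le \<delta> by auto
  have c1: "((\<lambda>x::complex. z + x *s b) \<longlongrightarrow> z + 0 *s b) (nhds 0)"
    unfolding vector_scalar_mult_def by (intro tendsto_intros tendsto_vec_lambda filterlim_ident)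
  have "\<forall>\<^sub>F x::complex in nhds 0. z + x *s b \<in> \<Omega>"
    using topological_tendstoD[OF c1 op] \<open>z \<in> \<Omega>\<close> by simp
  moreover have "\<forall>\<^sub>F x in nhds 0. norm (r x) \<le> e * norm x"
    unfolding r_def by (rule eventually_norm_vec_linearization_le[OF deriv e(1)])
  ultimately have "\<forall>\<^sub>F x in nhds 0. z + x *s b \<in> \<Omega> \<and> norm (r x) \<le> e * norm x"
    by (rule eventually_conj)
  then obtain s where s: "s > 0"
     "\<And>x. norm x < s \<Longrightarrow> z + x *s b \<in> \<Omega> \<and> norm (r x) \<le> e * norm x"
    unfolding eventually_nhds_metric by (auto simp: dist_norm)
  \<comment> \<open>The three bounds keep the tangent disc in \<Omega> with a small error,
    \<open>w + x\<close> in the open unit disc, and the new shift \<open>v - r x\<close> in the ball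
    of radius \<open>\<delta>\<close>.\<close>
  define \<eta> where "\<eta> = Min {s / 2, (1 - norm w) / 2, (\<delta> - norm v) / e}"
  have \<eta>: "0 < \<eta>" "\<eta> < s" "norm w + \<eta> < 1" "norm v + e * \<eta> \<le> \<delta>"
  proof -
    show "0 < \<eta>" using s w v e by (auto simp: \<eta>_def)
    have "\<eta> \<le> s / 2" "\<eta> \<le> (1 - norm w) / 2" "\<eta> \<le> (\<delta> - norm v) / e"
      unfolding \<eta>_def by (rule Min_le; simp)+
    then show "\<eta> < s" "norm w + \<eta> < 1" "norm v + e * \<eta> \<le> \<delta>"
      using s w e by (auto simp: field_simps)
  qed
  text \<open>The first-order terms of the penalty and of \<open>\<epsilon> \<bar>w\<bar>\<^sup>2\<close> are the real part of a
    holomorphic function vanishing at the origin, so they drop out of the circular mean.\<close>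
  define G where "G = (\<lambda>x. 2 * (\<Sum>j\<in>UNIV. of_real K * cnj (v $ j) * r x $ j) + 2 * of_real \<epsilon> * cnj w * x)"
  \<comment> \<open>The maximum is compared with the value at \<open>(v - r x, w + x)\<close>. The
    new shift cancels the linearization error, so the point of evaluation \<open>z + x *s b\<close>
    lies exactly on the tangent line, where the sub-mean value inequality is available.\<close>
  have ptw: "u (z + x *s b) \<le> u z - \<epsilon> / 2 * \<eta>\<^sup>2 - Re (G x)" if x: "norm x = \<eta>" for x
  proof -
    have rx: "norm (r x) \<le> e * \<eta>" using s(2)[of x] x \<eta> by auto
    have "\<Psi> (v - r x, w + x) \<le> \<Psi> (v, w)"
    proof -
      have "norm (v - r x) \<le> \<delta>" using norm_triangle_ineq4[of v "r x"] rx \<eta> by auto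
      moreover have "norm (w + x) \<le> 1" using norm_triangle_ineq[of w x] x \<eta> by auto
      ultimately show ?thesis using p(2)[of "(v - r x, w + x)"] vw by auto
    qed
    moreover have "f (w + x) + (v - r x) = z + x *s b" by (simp add: r_def z_def algebra_simps)
    moreover have "(norm (w + x))\<^sup>2 = (norm w)\<^sup>2 + 2 * Re (cnj w * x) + \<eta>\<^sup>2"
      unfolding x[symmetric] cmod_power2 by (simp add: power2_eq_square algebra_simps)
    moreover have "(norm (v - r x))\<^sup>2 = (norm v)\<^sup>2 - 2 * (v \<bullet> r x) + (norm (r x))\<^sup>2"
      by (simp add: power2_norm_eq_inner inner_diff inner_commute algebra_simps)
    moreover have "v \<bullet> r x = Re (\<Sum>j\<in>UNIV. cnj (v $ j) * r x $ j)"
      by (simp add: inner_vec_def inner_complex_def)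
    moreover have "(norm (r x))\<^sup>2 \<le> (e * \<eta>)\<^sup>2" using rx by (intro power_mono) auto
    then have "K * (norm (r x))\<^sup>2 \<le> K * (e * \<eta>)\<^sup>2" using K by simp
    then have "K * (norm (r x))\<^sup>2 \<le> \<epsilon> / 2 * \<eta>\<^sup>2" using e(2) by (simp add: power_mult_distrib flip: mult.assoc)
    moreover have "Re (G x) = 2 * K * Re (\<Sum>j\<in>UNIV. cnj (v $ j) * r x $ j) + 2 * \<epsilon> * Re (cnj w * x)"
      by (simp add: G_def sum_distrib_left algebra_simps)
    ultimately show ?thesis
      by (simp add: \<Psi>_def z_def algebra_simps del: Re_sum)
  qed
  have "G holomorphic_on cball 0 \<eta>"
  proof -
    have "(\<lambda>x. r x $ j) holomorphic_on cball 0 \<eta>" for j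
    proof -
      have "(\<lambda>w. f w $ j) \<circ> (\<lambda>x. w + x) holomorphic_on cball 0 \<eta>"
      proof (intro holomorphic_on_compose_gen[OF _ holf] holomorphic_intros)
        show "(+) w ` cball 0 \<eta> \<subseteq> ball 0 1"
        proof safe
          fix x assume "x \<in> cball (0::complex) \<eta>"
          then show "w + x \<in> ball 0 1" using \<eta>(3) norm_triangle_ineq[of w x] by simp
        qed
      qed
      then show ?thesis
        by (auto simp: r_def o_def intro!: holomorphic_intros)
    qed
    then show ?thesis unfolding G_def by (intro holomorphic_intros)
  qed
  from has_integral_Re_circle_mean[OF this \<eta>(1)]
  have "((\<lambda>t. Re (G (of_real \<eta> * cis t))) has_integral 0) {0..2*pi}"
    by (simp add: G_def r_def)
  then have I: "((\<lambda>t. u z - \<epsilon> / 2 * \<eta>\<^sup>2 - Re (G (of_real \<eta> * cis t))) has_integral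
      2 * pi * (u z - \<epsilon> / 2 * \<eta>\<^sup>2)) {0..2*pi}"
    using has_integral_diff[OF has_integral_const_real[of "u z - \<epsilon> / 2 * \<eta>\<^sup>2" 0 "2*pi"]] by fastforce
  \<comment> \<open>The radius \<open>\<eta>\<close> is absorbed into the direction, because
    plurisubharmonicity is stated for parameters in the closed unit disc.\<close>
  have inO: "z + \<zeta> *s (of_real \<eta> *s b) \<in> \<Omega>" if "\<zeta> \<in> cball 0 1" for \<zeta>
  proof -
    have "norm (\<zeta> * of_real \<eta>) \<le> \<eta>"
      using that \<eta> by (simp add: norm_mult mult_left_le_one_le)
    then show ?thesis using s(2)[of "\<zeta> * of_real \<eta>"] \<eta> by (simp add: vector_smult_assoc)
  qed
  then have "u z \<le> integral {0..2*pi} (\<lambda>t. u (z + cis t *s (of_real \<eta> *s b))) / (2*pi)"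
    using psh unfolding continuous_plurisubharmonic_on_def by blast
  moreover have "integral {0..2*pi} (\<lambda>t. u (z + cis t *s (of_real \<eta> *s b))) \<le> 2 * pi * (u z - \<epsilon> / 2 * \<eta>\<^sup>2)"
  proof (rule has_integral_le[OF integrable_integral I])
    have c2: "continuous_on {0..2*pi} (\<lambda>t. z + cis t *s (of_real \<eta> *s b))"
      unfolding vector_scalar_mult_def by (intro continuous_intros)
    show "(\<lambda>t. u (z + cis t *s (of_real \<eta> *s b))) integrable_on {0..2*pi}"
      using inO by (intro integrable_continuous_real continuous_on_compose2[OF contu c2]) auto
    show "u (z + cis t *s (of_real \<eta> *s b)) \<le> u z - \<epsilon> / 2 * \<eta>\<^sup>2 - Re (G (of_real \<eta> * cis t))" for t
      using ptw[of "of_real \<eta> * cis t"] \<eta>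
      by (simp add: vector_smult_assoc norm_mult mult.commute)
  qed
  ultimately have "2 * pi * u z \<le> 2 * pi * (u z - \<epsilon> / 2 * \<eta>\<^sup>2)"
    by (simp add: field_simps)
  then have "u z \<le> u z - \<epsilon> / 2 * \<eta>\<^sup>2" by simp
  then show False using \<epsilon> \<eta> by (simp add: mult_le_0_iff)
qed

section \<open>The continuity principle for families of discs\<close>

text \<open>The interval is connected, and two disjoint closed sets of parameters cover it:
  \<open>A\<close>, where the disc lies in a fixed sublevel set of the exhaustion, and
  \<open>B\<close>, where the disc leaves \<Omega>. The maximum principle gives the covering, and 0
  lies in \<open>A\<close>, so \<open>B\<close> is empty.\<close>

lemma continuity_principle:
  fixes F :: "real \<Rightarrow> complex \<Rightarrow> complex ^ 'n::finite"
  assumes psc: "pseudoconvex \<Omega>"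
    and contF: "continuous_on ({0..1} \<times> cball 0 1) (\<lambda>p. F (fst p) (snd p))"
    and holF: "\<And>\<alpha> j. \<alpha> \<in> {0..1} \<Longrightarrow> (\<lambda>w. F \<alpha> w $ j) holomorphic_on ball 0 1"
    and F0: "\<And>w. w \<in> cball 0 1 \<Longrightarrow> F 0 w \<in> \<Omega>"
    and bd: "\<And>\<alpha> w. \<alpha> \<in> {0..1} \<Longrightarrow> norm w = 1 \<Longrightarrow> F \<alpha> w \<in> \<Omega>"
    and mem: "\<alpha> \<in> {0..1}" "w \<in> cball 0 1"
  shows "F \<alpha> w \<in> \<Omega>"
proof -
  let ?F = "\<lambda>p. F (fst p) (snd p)"
  obtain u where psh: "continuous_plurisubharmonic_on u \<Omega>" and exh: "\<And>c. compact {z \<in> \<Omega>. u z \<le> c}"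
    and op: "open \<Omega>"
    using psc unfolding pseudoconvex_def by blast
  have "compact (?F ` ({0..1} \<times> sphere 0 1))"
    using contF by (intro compact_continuous_image compact_Times) (auto elim: continuous_on_subset)
  moreover have "?F ` ({0..1} \<times> sphere 0 1) \<subseteq> \<Omega>" using bd by auto
  ultimately have "compact (u ` ?F ` ({0..1} \<times> sphere 0 1))"
    using psh unfolding continuous_plurisubharmonic_on_def
    by (intro compact_continuous_image[of _ u]) (auto intro: continuous_on_subset)
  then have "bdd_above (u ` ?F ` ({0..1} \<times> sphere 0 1))"
    by (intro bounded_imp_bdd_above compact_imp_bounded)
  then obtain c where "\<And>y. y \<in> u ` ?F ` ({0..1} \<times> sphere 0 1) \<Longrightarrow> y \<le> c"
    unfolding bdd_above_def by blast
  moreover have "u (?F (\<alpha>, w)) \<in> u ` ?F ` ({0..1} \<times> sphere 0 1)" if "\<alpha> \<in> {0..1}" "norm w = 1" for \<alpha> w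
    using that by (intro imageI) auto
  ultimately have c: "u (F \<alpha> w) \<le> c" if "\<alpha> \<in> {0..1}" "norm w = 1" for \<alpha> w
    using that by simp
  \<comment> \<open>The bound \<open>c\<close> holds on all boundary circles at once, so one
    sublevel set serves every parameter. Being compact, it is closed in the whole space and not only
    in \<Omega>, which makes \<open>A\<close> closed.\<close>
  define C where "C = {z \<in> \<Omega>. u z \<le> c}"
  have clC: "closed C" unfolding C_def using exh compact_imp_closed by blast
  define A where "A = {\<alpha> \<in> {0..1}. \<forall>w \<in> cball 0 1. F \<alpha> w \<in> C}"
  define B where "B = fst ` (({0..1} \<times> cball 0 1) \<inter> ?F -` (- \<Omega>))"
  have contF1: "continuous_on {0..1} (\<lambda>\<alpha>. F \<alpha> w)" if "w \<in> cball 0 1" for w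
  proof -
    have "continuous_on {0..1} (\<lambda>\<alpha>. ?F (\<alpha>, w))"
      by (rule continuous_on_compose2[OF contF]) (use that in \<open>auto intro!: continuous_intros\<close>)
    then show ?thesis by simp
  qed
  have contF2: "continuous_on (cball 0 1) (F \<alpha>)" if "\<alpha> \<in> {0..1}" for \<alpha>
  proof -
    have "continuous_on (cball 0 1) (\<lambda>w. ?F (\<alpha>, w))"
      by (rule continuous_on_compose2[OF contF]) (use that in \<open>auto intro!: continuous_intros\<close>)
    then show ?thesis by simp
  qed
  have "A = (\<Inter>w\<in>cball 0 1. {0..1} \<inter> (\<lambda>\<alpha>. F \<alpha> w) -` C)"
    by (force simp: A_def)
  moreover have "closed ({0..1} \<inter> (\<lambda>\<alpha>. F \<alpha> w) -` C)" if "w \<in> cball 0 1" for w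
    using continuous_closed_preimage[OF contF1[OF that] _ clC] by simp
  then have "closed (\<Inter>w\<in>cball 0 1. {0..1} \<inter> (\<lambda>\<alpha>. F \<alpha> w) -` C)"
    by (intro closed_INT ballI)
  ultimately have clA: "closed A" by (simp only:)
  \<comment> \<open>\<open>B\<close> is closed as the projection of a compact set: the parameter
    pairs sent outside the open set \<Omega> form a closed subset of a compact product.\<close>
  have "closed (({0..1} \<times> cball 0 1) \<inter> ?F -` (- \<Omega>))"
    using continuous_closed_preimage[OF contF, of "- \<Omega>"] op by (simp add: closed_Times closed_Compl)
  then have "compact (({0..1} \<times> cball 0 1) \<inter> (({0..1} \<times> cball 0 1) \<inter> ?F -` (- \<Omega>)))"
    by (intro compact_Int_closed compact_Times) auto
  then have "compact (({0..1} \<times> cball 0 1) \<inter> ?F -` (- \<Omega>))"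
    by (simp only: Int_left_absorb)
  then have "compact B"
    unfolding B_def by (rule compact_continuous_image[rotated]) (intro continuous_intros)
  then have clB: "closed B" by (rule compact_imp_closed)
  have cover: "{0..1} \<subseteq> A \<union> B"
  proof
    fix \<alpha> :: real assume \<alpha>: "\<alpha> \<in> {0..1}"
    show "\<alpha> \<in> A \<union> B"
    proof (cases "F \<alpha> ` cball 0 1 \<subseteq> \<Omega>")
      case True
      have "u (F \<alpha> w) \<le> c" if "w \<in> cball 0 1" for w
        using psh_disc_le_boundary[OF psh op contF2[OF \<alpha>] holF[OF \<alpha>] True c[OF \<alpha>] that] .
      then show ?thesis using True \<alpha> by (auto simp: A_def C_def)
    next
      case False
      then obtain w where "w \<in> cball 0 1" "F \<alpha> w \<notin> \<Omega>" by blast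
      then have "\<alpha> \<in> B" unfolding B_def using \<alpha> by (intro image_eqI[of _ _ "(\<alpha>, w)"]) auto
      then show ?thesis by simp
    qed
  qed
  have disj: "A \<inter> B = {}" by (auto simp: A_def B_def C_def)
  have "0 \<in> A"
  proof -
    have "0 \<notin> B" using F0 by (auto simp: B_def)
    moreover have "0 \<in> A \<union> B" using cover by (rule subsetD) simp
    ultimately show ?thesis by blast
  qed
  then have "B \<inter> {0..1} = {}"
    using connected_closedD[of "{0..1::real}" A B] clA clB cover disj by auto
  then have "\<alpha> \<in> A" using cover mem by blast
  then show ?thesis using mem by (auto simp: A_def C_def)
qed

section \<open>Dilations, the Minkowski functional and the model discs\<close>

lemma minkowski_functional_le:
  assumes "t > 0" "(\<chi> j. z $ j / complex_of_real t ^ \<Lambda> j) \<in> \<Omega>"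
  shows "minkowski_functional \<Lambda> \<Omega> z \<le> t"
  unfolding minkowski_functional_def
  using assms by (intro cInf_lower bdd_belowI[of _ 0]) auto

text \<open>Openness leaves room to expand \<open>z\<close> slightly. This makes the Minkowski
  functional strictly less than 1 on \<Omega>, so that its \<open>artanh\<close> is
  meaningful.\<close>

lemma open_imp_dilation_mem:
  fixes \<Omega> :: "(complex ^ 'n::finite) set"
  assumes op: "open \<Omega>" and z: "z \<in> \<Omega>"
  obtains t where "0 < t" "t < 1" "(\<chi> j. z $ j / complex_of_real t ^ \<Lambda> j) \<in> \<Omega>"
proof -
  have "((\<lambda>t. \<chi> j. z $ j / complex_of_real t ^ \<Lambda> j) \<longlongrightarrow> (\<chi> j. z $ j / complex_of_real 1 ^ \<Lambda> j)) (at_left 1)"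
    by (intro tendsto_intros tendsto_vec_lambda) auto
  then have "\<forall>\<^sub>F t in at_left 1. (\<chi> j. z $ j / complex_of_real t ^ \<Lambda> j) \<in> \<Omega>"
    using op z by (auto dest: topological_tendstoD)
  moreover have "\<forall>\<^sub>F t in at_left 1. t \<in> {0<..<1::real}"
    by (rule eventually_at_left_real) auto
  ultimately have "\<forall>\<^sub>F t in at_left (1::real). t \<in> {0<..<1} \<and> (\<chi> j. z $ j / complex_of_real t ^ \<Lambda> j) \<in> \<Omega>"
    by eventually_elim auto
  then obtain t :: real where "t \<in> {0<..<1}" "(\<chi> j. z $ j / complex_of_real t ^ \<Lambda> j) \<in> \<Omega>"
    using eventually_happens trivial_limit_at_left_real by blast
  then show thesis by (intro that) auto
qed

lemma poincare_dist_0: "poincare_dist 0 \<zeta> = artanh (norm \<zeta>)"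
  by (simp add: poincare_dist_def)

lemma balancedD:
  assumes "nonisotropically_balanced \<Lambda> \<Omega>" "x \<in> \<Omega>" "norm \<zeta> \<le> 1"
  shows "(\<chi> j. \<zeta> ^ \<Lambda> j * x $ j) \<in> \<Omega>"
  using assms by (auto simp: nonisotropically_balanced_def)

lemma balanced_disc:
  fixes \<Omega> :: "(complex ^ 'n::finite) set"
  assumes bal: "nonisotropically_balanced \<Lambda> \<Omega>" and pos: "\<And>j. \<Lambda> j > 0"
    and t: "0 < t" "(\<chi> j. z $ j / complex_of_real t ^ \<Lambda> j) \<in> \<Omega>"
  shows "\<exists>\<phi>. holomorphic_map (ball 0 1) \<Omega> \<phi> \<and> \<phi> 0 = 0 \<and> \<phi> (of_real t) = z"
proof (intro exI conjI)
  let ?\<phi> = "\<lambda>\<zeta>. \<chi> j. \<zeta> ^ \<Lambda> j * (z $ j / complex_of_real t ^ \<Lambda> j)"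
  show "holomorphic_map (ball 0 1) \<Omega> ?\<phi>"
    unfolding holomorphic_map_def using balancedD[OF bal t(2)] t
    by (auto intro!: holomorphic_intros)
  show "?\<phi> 0 = 0" using pos by (simp add: vec_eq_iff zero_power)
  show "?\<phi> (of_real t) = z" using t by (simp add: vec_eq_iff)
qed

section \<open>The lower estimate by the continuity principle\<close>

lemma disc_through_origin:
  fixes \<Omega> :: "(complex ^ 'n::finite) set"
  assumes bal: "nonisotropically_balanced \<Lambda> \<Omega>" and pos: "\<And>j. \<Lambda> j > 0"
    and le: "\<And>j. \<Lambda> j \<le> L"
    and psc: "pseudoconvex \<Omega>"
    and hol: "holomorphic_map (ball 0 1) \<Omega> \<phi>" and \<phi>0: "\<phi> 0 = 0"
    and r: "0 < r" "r < 1" and w: "0 < norm w" "norm w \<le> 1"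
  shows "(\<chi> j. \<phi> (of_real r * w ^ L) $ j / w ^ \<Lambda> j) \<in> \<Omega>"
proof -
  have "\<exists>\<psi>. \<psi> holomorphic_on ball 0 1 \<and> (\<forall>x\<in>ball 0 1. \<phi> x $ j = x * \<psi> x)" for j
  proof -
    let ?g = "\<lambda>x. \<phi> x $ j"
    \<comment> \<open>The singularity of the quotient at 0 is removable because
      \<open>\<phi> 0 = 0\<close>; the derivative is the value that fills it.\<close>
    let ?\<psi> = "\<lambda>x. if x = 0 then deriv ?g 0 else ?g x / x"
    have "?\<psi> holomorphic_on ball 0 1"
    proof (rule pole_theorem_open_0)
      show "?g holomorphic_on ball 0 1" using hol by (simp add: holomorphic_map_def)
      show "?g x = (x - 0) * ?\<psi> x" if "x \<in> ball 0 1 - {0}" for x using that by simp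
    qed (simp_all add: \<phi>0)
    moreover have "\<phi> x $ j = x * ?\<psi> x" for x by (simp add: \<phi>0)
    ultimately show ?thesis by blast
  qed
  then have "\<forall>j. \<exists>\<psi>. \<psi> holomorphic_on ball 0 1 \<and> (\<forall>x\<in>ball 0 1. \<phi> x $ j = x * \<psi> x)" by blast
  from choice[OF this]
  obtain \<psi> where "\<forall>j. \<psi> j holomorphic_on ball 0 1 \<and> (\<forall>x\<in>ball 0 1. \<phi> x $ j = x * \<psi> j x)" ..
  then have \<psi>: "\<psi> j holomorphic_on ball 0 1" "norm x < 1 \<Longrightarrow> \<phi> x $ j = x * \<psi> j x" for j x
    by auto
  have contpsi: "continuous_on (ball 0 1) (\<psi> j)" for j
    using \<psi>(1) holomorphic_on_imp_continuous_on by blast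
  \<comment> \<open>The factor \<open>r < 1\<close> keeps the image of the closed disc inside the
    open disc on which \<open>\<phi>\<close> is defined, so the discs of the family extend to their
    boundaries.\<close>
  have small: "norm (of_real r * x ^ L) < 1" if "norm x \<le> 1" for x :: complex
  proof -
    have "norm (of_real r * x ^ L) \<le> r"
      using r that by (simp add: norm_mult norm_power mult_left_le power_le_one)
    then show ?thesis using r by linarith
  qed
  \<comment> \<open>One factor \<open>r * w ^ L\<close> is split off from \<open>\<phi>\<close> and
    cancelled against \<open>w ^ \<Lambda> j\<close>. No division by \<open>w\<close> remains, so
    \<open>F\<close> is holomorphic and continuous also at 0.\<close>
  define F where "F = (\<lambda>(\<alpha>::real) w. \<chi> j. of_real \<alpha> ^ \<Lambda> j * (of_real r * w ^ (L - \<Lambda> j) * \<psi> j (of_real r * w ^ L)))"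
  have F: "F \<alpha> x = (\<chi> j. (of_real \<alpha> / x) ^ \<Lambda> j * \<phi> (of_real r * x ^ L) $ j)"
    if "0 < norm x" "norm x \<le> 1" for \<alpha> x
  proof -
    have "of_real \<alpha> ^ \<Lambda> j * (of_real r * x ^ (L - \<Lambda> j) * y) = (of_real \<alpha> / x) ^ \<Lambda> j * (of_real r * x ^ L * y)"
      for j y
    proof -
      have xL: "x ^ L = x ^ (L - \<Lambda> j) * x ^ \<Lambda> j"
        using le[of j] by (metis le_add_diff_inverse2 power_add)
      have "x \<noteq> 0" using that by auto
      then show ?thesis unfolding xL power_divide by simp
    qed
    then show ?thesis
      unfolding F_def \<psi>(2)[OF small[OF that(2)]] by (simp only:)
  qed
  have \<phi>in: "\<phi> x \<in> \<Omega>" if "norm x < 1" for x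
    using hol that by (auto simp: holomorphic_map_def)
  have "F 1 w \<in> \<Omega>"
  proof (rule continuity_principle[OF psc, where F = F])
    show "continuous_on ({0..1} \<times> cball 0 1) (\<lambda>p. F (fst p) (snd p))"
      unfolding F_def using small
      by (intro continuous_intros continuous_on_compose2[OF contpsi]) auto
    show "(\<lambda>w. F \<alpha> w $ j) holomorphic_on ball 0 1" for \<alpha> j
    proof -
      have "(\<psi> j \<circ> (\<lambda>w. of_real r * w ^ L)) holomorphic_on ball 0 1"
        using small by (intro holomorphic_on_compose_gen[OF _ \<psi>(1)] holomorphic_intros) auto
      then show ?thesis unfolding F_def o_def by (auto intro!: holomorphic_intros)
    qed
    show "F 0 x \<in> \<Omega>" for x
    proof -
      have "F 0 x = \<phi> 0" using \<phi>0 pos by (simp add: F_def vec_eq_iff zero_power)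
      then show ?thesis using \<phi>in by simp
    qed
    \<comment> \<open>On the unit circle \<open>\<alpha> / x\<close> has modulus
      \<open>\<alpha> \<le> 1\<close>, so \<open>F \<alpha> x\<close> arises from a point of
      \<Omega> by the balanced action.\<close>
    show "F \<alpha> x \<in> \<Omega>" if "\<alpha> \<in> {0..1}" "norm x = 1" for \<alpha> x
      using balancedD[OF bal \<phi>in[OF small], of x "of_real \<alpha> / x"] F[of x \<alpha>] that
      by (simp add: norm_divide)
  qed (use w in auto)
  then show ?thesis using F[of w 1] w by (simp add: power_divide)
qed

text \<open>For \<open>w\<close> with \<open>w ^ L = \<zeta> / r\<close>, the point
  \<open>\<phi> \<zeta>\<close> dilated by \<open>w\<close> lies in \<Omega>. This bounds the
  functional by \<open>norm w\<close>, whose power is \<open>norm \<zeta> / r\<close>, and then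
  \<open>r\<close> tends to 1.\<close>

lemma minkowski_functional_power_le:
  fixes \<Omega> :: "(complex ^ 'n::finite) set"
  assumes bal: "nonisotropically_balanced \<Lambda> \<Omega>" and pos: "\<And>j. \<Lambda> j > 0"
    and le: "\<And>j. \<Lambda> j \<le> L"
    and psc: "pseudoconvex \<Omega>"
    and hol: "holomorphic_map (ball 0 1) \<Omega> \<phi>" and \<phi>0: "\<phi> 0 = 0"
    and \<zeta>: "norm \<zeta> < 1"
  shows "minkowski_functional \<Lambda> \<Omega> (\<phi> \<zeta>) ^ L \<le> norm \<zeta>"
proof -
  let ?h = "minkowski_functional \<Lambda> \<Omega> (\<phi> \<zeta>)"
  have "L > 0" using pos le by (meson less_le_trans)
  have h0: "?h \<ge> 0"
  proof -
    have "\<phi> \<zeta> \<in> \<Omega>" using hol \<zeta> by (auto simp: holomorphic_map_def)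
    then show ?thesis unfolding minkowski_functional_def
      by (intro cInf_greatest) (auto intro!: exI[of _ "1::real"])
  qed
  show ?thesis
  \<comment> \<open>At 0 the root \<open>w\<close> would vanish and could not be divided by. There
    \<open>\<phi> \<zeta> = 0\<close>, all of whose dilations lie in \<Omega>, so the functional is
    0.\<close>
  proof (cases "\<zeta> = 0")
    case True
    have "0 \<in> \<Omega>" using hol \<phi>0 by (force simp: holomorphic_map_def)
    moreover have "(\<chi> j. (0::complex^'n) $ j / complex_of_real t ^ \<Lambda> j) = 0" for t
      by (simp add: vec_eq_iff)
    ultimately have "?h \<le> t" if "t > 0" for t
      using that True \<phi>0 by (intro minkowski_functional_le) auto
    then have "?h \<le> 0" by (meson dense_ge)
    then show ?thesis using h0 True \<open>L > 0\<close> by (simp add: zero_power)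
  next
    case False
    have *: "?h ^ L \<le> norm \<zeta> / r" if r: "norm \<zeta> < r" "r < 1" for r
    proof -
      have r0: "r > 0" using r by (meson le_less_trans norm_ge_zero)
      obtain w where w: "\<zeta> / of_real r = w ^ L"
        using exists_complex_root[of L "\<zeta> / of_real r"] \<open>L > 0\<close> by auto
      have nw: "norm w ^ L = norm \<zeta> / r"
        using arg_cong[OF w, of norm] r0 by (simp add: norm_divide norm_power)
      have "w \<noteq> 0" using w False r0 \<open>L > 0\<close> by (auto simp: zero_power)
      moreover have "norm w \<le> 1"
      proof (rule ccontr)
        assume "\<not> norm w \<le> 1"
        then have "norm w ^ L \<ge> 1" by (intro one_le_power) auto
        then show False using nw r r0 by (simp add: field_simps)
      qed
      ultimately have "(\<chi> j. \<phi> (of_real r * w ^ L) $ j / w ^ \<Lambda> j) \<in> \<Omega>"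
        using disc_through_origin[OF bal pos le psc hol \<phi>0 r0 r(2), of w] by simp
      moreover have "of_real r * w ^ L = \<zeta>" using w r0 by (simp add: field_simps)
      ultimately have "(\<chi> j. \<phi> \<zeta> $ j / w ^ \<Lambda> j) \<in> \<Omega>" by simp
      \<comment> \<open>The unimodular rotation by \<open>w / norm w\<close> turns the complex
        divisor \<open>w\<close> into the positive real divisor \<open>norm w\<close> that the
        Minkowski functional requires.\<close>
      from balancedD[OF bal this, of "w / of_real (norm w)"]
      have "(\<chi> j. \<phi> \<zeta> $ j / complex_of_real (norm w) ^ \<Lambda> j) \<in> \<Omega>"
        using \<open>w \<noteq> 0\<close> by (simp add: norm_divide power_divide)
      then have "?h \<le> norm w"
        using \<open>w \<noteq> 0\<close> by (intro minkowski_functional_le) auto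
      then show ?thesis using h0 nw by (metis power_mono)
    qed
    have "((\<lambda>r. norm \<zeta> / r) \<longlongrightarrow> norm \<zeta> / 1) (at_left 1)"
      by (intro tendsto_intros) auto
    moreover have "\<forall>\<^sub>F r in at_left 1. r \<in> {norm \<zeta><..<1}"
      using \<zeta> by (rule eventually_at_left_real)
    then have "\<forall>\<^sub>F r in at_left 1. ?h ^ L \<le> norm \<zeta> / r"
      by eventually_elim (use * in auto)
    ultimately show ?thesis
      using tendsto_lowerbound[of "\<lambda>r. norm \<zeta> / r"] by fastforce
  qed
qed

section \<open>Both bounds for the Lempert function\<close>

theorem theorem1p6:
  fixes \<Lambda> :: "'n::finite \<Rightarrow> nat"
    and \<Omega> :: "(complex ^ 'n) set"
    and z :: "complex ^ 'n"
  assumes "CARD('n) \<ge> 2"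
    and "\<And>j. \<Lambda> j > 0"
    and "Gcd (range \<Lambda>) = 1"
    and "nonisotropically_balanced \<Lambda> \<Omega>"
    and "pseudoconvex \<Omega>"
    and "z \<in> \<Omega>"
  shows "artanh (minkowski_functional \<Lambda> \<Omega> z ^ Max (range \<Lambda>)) \<le> lempert_function \<Omega> 0 z
       \<and> lempert_function \<Omega> 0 z \<le> artanh (minkowski_functional \<Lambda> \<Omega> z)"
proof
  let ?h = "minkowski_functional \<Lambda> \<Omega> z" and ?L = "Max (range \<Lambda>)"
  define P where "P = {poincare_dist 0 \<zeta> | \<zeta>. \<zeta> \<in> ball 0 1 \<and>
            (\<exists>\<phi>. holomorphic_map (ball 0 1) \<Omega> \<phi> \<and> \<phi> 0 = 0 \<and> \<phi> \<zeta> = z)}"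
  have lempert: "lempert_function \<Omega> 0 z = Inf P"
    by (simp add: lempert_function_def P_def)
  define S where "S = {t. t > 0 \<and> (\<chi> j. z $ j / complex_of_real t ^ \<Lambda> j) \<in> \<Omega>}"
  have h: "?h = Inf S" by (simp add: minkowski_functional_def S_def)
  have op: "open \<Omega>" using assms(5) by (simp add: pseudoconvex_def)
  obtain t where t: "t \<in> S" "t < 1"
    using open_imp_dilation_mem[OF op assms(6), of \<Lambda>] by (auto simp: S_def)
  have h0: "0 \<le> ?h" unfolding h using t by (intro cInf_greatest) (auto simp: S_def)
  have h1: "?h < 1" using minkowski_functional_le[of t z \<Lambda> \<Omega>] t by (auto simp: S_def)
  have disc: "artanh s \<in> P" if "s \<in> S" "s < 1" for s
  proof -
    have "0 < s" using that by (simp add: S_def)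
    moreover have "\<exists>\<phi>. holomorphic_map (ball 0 1) \<Omega> \<phi> \<and> \<phi> 0 = 0 \<and> \<phi> (of_real s) = z"
      using that by (intro balanced_disc[OF assms(4,2)]) (auto simp: S_def)
    ultimately show ?thesis using that
      unfolding P_def by (intro CollectI exI[of _ "complex_of_real s"]) (auto simp: poincare_dist_0)
  qed
  show "artanh (?h ^ ?L) \<le> lempert_function \<Omega> 0 z"
    unfolding lempert
  proof (rule cInf_greatest)
    show "P \<noteq> {}" using disc t by auto
    fix x assume "x \<in> P"
    then obtain \<zeta> \<phi> where x: "x = artanh (norm \<zeta>)" "norm \<zeta> < 1"
      and \<phi>: "holomorphic_map (ball 0 1) \<Omega> \<phi>" "\<phi> 0 = 0" "\<phi> \<zeta> = z"
      by (auto simp: P_def poincare_dist_0)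
    have le: "?h ^ ?L \<le> norm \<zeta>"
      using minkowski_functional_power_le[OF assms(4,2) _ assms(5) \<phi>(1,2) x(2), of ?L] \<phi>(3) by simp
    moreover have "0 \<le> ?h ^ ?L" using h0 by simp
    ultimately show "artanh (?h ^ ?L) \<le> x"
      using x by (simp add: artanh_real_le_iff)
  qed
  have "bdd_below P"
  proof (rule bdd_belowI)
    fix x assume "x \<in> P"
    then obtain \<zeta> :: complex where "x = artanh (norm \<zeta>)" "norm \<zeta> < 1"
      by (auto simp: P_def poincare_dist_0)
    then show "0 \<le> x" using artanh_real_le_iff[of 0 "norm \<zeta>"] by simp
  qed
  \<comment> \<open>Comparing through \<open>tanh\<close> allows the infimum over all of
    \<open>S\<close>: for \<open>s \<ge> 1\<close> the bound is trivial since \<open>tanh\<close>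
    stays below 1, and for \<open>s < 1\<close> the model disc gives it. No limit of
    \<open>artanh\<close> along \<open>S\<close> has to be taken.\<close>
  then have "tanh (Inf P) \<le> s" if "s \<in> S" for s
  proof (cases "s < 1")
    case True
    then have "Inf P \<le> artanh s" using disc that \<open>bdd_below P\<close> by (intro cInf_lower) auto
    then have "tanh (Inf P) \<le> tanh (artanh s)" by simp
    also have "\<dots> = s" using True that by (intro tanh_artanh_real) (auto simp: S_def)
    finally show ?thesis .
  next
    case False
    then show ?thesis using tanh_real_lt_1[of "Inf P"] by linarith
  qed
  then have "tanh (Inf P) \<le> ?h" unfolding h using t by (intro cInf_greatest) auto
  also have "?h = tanh (artanh ?h)" using h0 h1 by (simp add: tanh_artanh_real)
  finally show "lempert_function \<Omega> 0 z \<le> artanh ?h" by (simp add: lempert)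
qed

end
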